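(* Let $\mathcal L_{\mathrm{sc}}$ be the class of all loss functions $l:\mathcal Z\times\Omega\to\mathbb R$ that are $\alpha$-strongly convex and $\beta$-smooth (in $\theta$, for every $z\in\mathcal Z$), where $|\Omega|=R$, and let $\kappa=\beta/\alpha$; assume that for all $z\in\mathcal Z$ there exists $\theta^*\in\Omega$ such that $\nabla l(\theta^*;z)=0$ (so that the losses are $R\beta$-Lipschitz). There is a universal constant $C_3>0$ such that for gradient descent with fixed step-size $\eta\le\frac1\beta$, at iteration $T\ge1$ and for sample size $n$, $$\mathcal E_{\mathrm{opt}}^{\mathrm{GD}}(T,n,\mathcal L_{\mathrm{sc}})\ge\frac{\beta R^2}{C_3\,n}-\frac{4(R\beta)^2}{\alpha n}+\frac{4(R\beta)^2}{\alpha n}\left(1-\frac{\eta\beta}{1+\kappa}\right)^{T}.$$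
   Context: $\Omega\subset\mathbb R^d$ is the parameter space and $|\Omega|=R$ is its size (diameter). Samples lie in a space $\mathcal Z$, and $\mathcal P$ is a class of distributions on $\mathcal Z$; for a sample $S=(z_1,\dots,z_n)$ drawn i.i.d. from $P\in\mathcal P$, the empirical risk is $R_S(\theta)=\frac1n\sum_{i=1}^n l(\theta;z_i)$. Gradient descent (GD) starts at some initial point $\theta_0\in\Omega$ and iterates $\theta_{t+1}=\theta_t-\eta\nabla R_S(\theta_t)$, $t\ge0$, with output $\hat\theta_T=\theta_T$ at iteration $T$. The worst-case optimization error is $\mathcal E_{\mathrm{opt}}^{\mathrm{GD}}(T,n,\mathcal L_{\mathrm{sc}})=\sup_{l\in\mathcal L_{\mathrm{sc}},P\in\mathcal P}\mathbb E_{S\sim P^n}[R_S(\hat\theta_T)-R_S(\hat\theta_{\mathrm{ERM}})]$ with $\hat\theta_{\mathrm{ERM}}$ a minimizer of $R_S$. A continuously differentiable $f$ is $\beta$-smooth if $\|\nabla f(u)-\nabla f(v)\|_2\le\beta\|u-v\|_2$ for all $u,v\in\Omega$; $f$ is $\alpha$-strongly convex if $f(u)\ge f(v)+\langle\nabla f(v),u-v\rangle+\frac\alpha2\|u-v\|_2^2$ for all $u,v\in\Omega$. A function $f$ is $L$-Lipschitz if $|f(u)-f(v)|\le L\|u-v\|_2$ for all $u,v\in\Omega$.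
   Formalization: The parameter space Ω is assumed convex, since the claim fails e.g. for two small far-apart intervals; the worst case ranges over losses and distributions for which the gradient descent iterates almost surely stay in Ω and an ERM exists. *)

theory Defs
  imports "HOL-Probability.Probability"
begin

text \<open>
  A loss \<open>l : Z \<times> \<Omega> \<rightarrow> \<real>\<close> is a curried function \<open>l z \<theta>\<close> on the whole Euclidean space, but all
  analytic conditions below concern its behaviour at points of \<open>\<Omega>\<close> only.
  \<open>GDERIV\<close> is the derivative at a point in the full space, so the gradient is unique also at
  boundary points of \<open>\<Omega>\<close> and for \<open>\<Omega>\<close> with empty interior.
\<close>

definition gradient :: "(real ^ 'd \<Rightarrow> real) \<Rightarrow> real ^ 'd \<Rightarrow> real ^ 'd" where
  "gradient f u = (THE g. GDERIV f u :> g)"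

definition C1_on :: "(real ^ 'd) set \<Rightarrow> (real ^ 'd \<Rightarrow> real) \<Rightarrow> bool" where
  "C1_on \<Omega> f \<longleftrightarrow> (\<forall>u\<in>\<Omega>. \<exists>g. GDERIV f u :> g) \<and> continuous_on \<Omega> (gradient f)"

definition smooth_on_with :: "(real ^ 'd) set \<Rightarrow> real \<Rightarrow> (real ^ 'd \<Rightarrow> real) \<Rightarrow> bool" where
  "smooth_on_with \<Omega> \<beta> f \<longleftrightarrow> C1_on \<Omega> f \<and>
     (\<forall>u\<in>\<Omega>. \<forall>v\<in>\<Omega>. norm (gradient f u - gradient f v) \<le> \<beta> * norm (u - v))"

definition strongly_convex_on :: "(real ^ 'd) set \<Rightarrow> real \<Rightarrow> (real ^ 'd \<Rightarrow> real) \<Rightarrow> bool" where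
  "strongly_convex_on \<Omega> \<alpha> f \<longleftrightarrow> C1_on \<Omega> f \<and>
     (\<forall>u\<in>\<Omega>. \<forall>v\<in>\<Omega>. f u \<ge> f v + gradient f v \<bullet> (u - v) + \<alpha> / 2 * (norm (u - v))\<^sup>2)"

text \<open>
  The sample space is \<open>space Z\<close>. Measurability in the sample is what gives the expectation of the
  empirical risk a meaning.
\<close>

definition L_sc :: "'z measure \<Rightarrow> (real ^ 'd) set \<Rightarrow> real \<Rightarrow> real \<Rightarrow> ('z \<Rightarrow> real ^ 'd \<Rightarrow> real) set" where
  "L_sc Z \<Omega> \<alpha> \<beta> = {l. (\<forall>\<theta>. (\<lambda>z. l z \<theta>) \<in> borel_measurable Z) \<and>
     (\<forall>z\<in>space Z. strongly_convex_on \<Omega> \<alpha> (l z) \<and> smooth_on_with \<Omega> \<beta> (l z) \<and>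
        (\<exists>\<theta>'\<in>\<Omega>. gradient (l z) \<theta>' = 0))}"

definition emp_risk :: "('z \<Rightarrow> real ^ 'd \<Rightarrow> real) \<Rightarrow> nat \<Rightarrow> (nat \<Rightarrow> 'z) \<Rightarrow> real ^ 'd \<Rightarrow> real" where
  "emp_risk l n S \<theta> = (1 / real n) * (\<Sum>i<n. l (S i) \<theta>)"

primrec gd :: "real \<Rightarrow> (real ^ 'd \<Rightarrow> real) \<Rightarrow> real ^ 'd \<Rightarrow> nat \<Rightarrow> real ^ 'd" where
  "gd \<eta> f \<theta>0 0 = \<theta>0"
| "gd \<eta> f \<theta>0 (Suc t) = gd \<eta> f \<theta>0 t - \<eta> *\<^sub>R gradient f (gd \<eta> f \<theta>0 t)"

text \<open>
  The losses live on \<open>\<Omega>\<close> only, so \<open>R\<^sub>S(\<theta>\<^sub>T) - R\<^sub>S(\<theta>\<^sub>E\<^sub>R\<^sub>M)\<close> makes sense only if the (unprojected) iterates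
  stay in \<open>\<Omega>\<close> and \<open>R\<^sub>S\<close> has a minimizer in \<open>\<Omega>\<close>. The supremum below ranges over the pairs \<open>(l, P)\<close> for
  which this holds almost surely; other pairs would only contribute values of \<open>l\<close> outside \<open>\<Omega>\<close>,
  which the conditions on \<open>l\<close> do not control.
\<close>

definition run_defined ::
  "(real ^ 'd) set \<Rightarrow> real \<Rightarrow> real ^ 'd \<Rightarrow> nat \<Rightarrow> nat \<Rightarrow> ('z \<Rightarrow> real ^ 'd \<Rightarrow> real) \<Rightarrow> 'z measure \<Rightarrow> bool" where
  "run_defined \<Omega> \<eta> \<theta>0 T n l P \<longleftrightarrow>
     (AE S in (\<Pi>\<^sub>M i\<in>{..<n}. P).
        (\<forall>t\<le>T. gd \<eta> (emp_risk l n S) \<theta>0 t \<in> \<Omega>) \<and>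
        (\<exists>\<theta>. is_arg_min (emp_risk l n S) (\<lambda>\<theta>. \<theta> \<in> \<Omega>) \<theta>))"

definition E_opt ::
  "(real ^ 'd) set \<Rightarrow> 'z measure set \<Rightarrow> real \<Rightarrow> real ^ 'd \<Rightarrow> nat \<Rightarrow> nat \<Rightarrow>
   ('z \<Rightarrow> real ^ 'd \<Rightarrow> real) set \<Rightarrow> ereal" where
  "E_opt \<Omega> \<P> \<eta> \<theta>0 T n L =
     (SUP (l, P) \<in> {(l, P). l \<in> L \<and> P \<in> \<P> \<and> run_defined \<Omega> \<eta> \<theta>0 T n l P}.
        ereal (\<integral>S. emp_risk l n S (gd \<eta> (emp_risk l n S) \<theta>0 T)
                 - emp_risk l n S (arg_min_on (emp_risk l n S) \<Omega>) \<partial>(\<Pi>\<^sub>M i\<in>{..<n}. P)))"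

text \<open>
  A universal constant must not depend on the dimension or on the sample space. These are types
  here, and an existential quantifier inside a polymorphic theorem could pick a constant for each
  type instance. An explicit numerical cap on the constant excludes this: the lower bound
  \<open>\<beta>R\<^sup>2/(C n) - \<dots>\<close> is antitone in \<open>C\<close>, so a bound with \<open>C\<close> below the cap at every instance also holds
  with \<open>C\<close> equal to the cap at all instances.
\<close>

definition universal_cap :: real where
  "universal_cap = 8"

end

(* For the deterministic loss f(x) = (\<beta>/2) |x - c|^2 with c in \<Omega>, gradient descent contracts towards c by the
   factor 1 - \<eta> \<beta> per step along the segment from \<theta>0 to c, so it stays in \<Omega> and its error after T steps is
   (\<beta>/2) |\<theta>0 - c|^2 (1 - \<eta> \<beta>)^(2T). For every r < R/2 some c has |\<theta>0 - c| >= r, so the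
   supremum is at least (\<beta> R^2 / 8) (1 - \<eta> \<beta>)^(2T). This dominates the claimed bound with C3 = 8,
   because 1 - (1 - x)^T is concave in x. *)

theory Submission
  imports Defs
begin

lemma gradient_eqI:
  assumes "GDERIV f u :> g"
  shows "gradient f u = g"
  unfolding gradient_def
proof (rule the_equality[where P = "\<lambda>g. GDERIV f u :> g", OF assms])
  fix h assume "GDERIV f u :> h"
  with assms have "(\<lambda>v. v \<bullet> h) = (\<lambda>v. v \<bullet> g)"
    unfolding gderiv_def by (rule has_derivative_unique[rotated])
  then have "v \<bullet> (h - g) = 0" for v
    by (metis inner_diff_right right_minus_eq)
  from this[of "h - g"] show "h = g" by simp
qed

definition quadratic_loss :: "real \<Rightarrow> real ^ 'd \<Rightarrow> real ^ 'd \<Rightarrow> real" where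
  "quadratic_loss b c x = b / 2 * (norm (x - c))\<^sup>2"

lemma GDERIV_quadratic_loss:
  "GDERIV (quadratic_loss b c) u :> b *\<^sub>R (u - c)"
  unfolding gderiv_def quadratic_loss_def power2_norm_eq_inner
  by (auto intro!: derivative_eq_intros simp: inner_commute algebra_simps)

lemma gradient_quadratic_loss:
  "gradient (quadratic_loss b c) u = b *\<^sub>R (u - c)"
  by (rule gradient_eqI[OF GDERIV_quadratic_loss])

lemma C1_on_quadratic_loss: "C1_on \<Omega> (quadratic_loss b c)"
  unfolding C1_on_def
  by (auto simp: gradient_quadratic_loss[abs_def] intro!: GDERIV_quadratic_loss exI continuous_intros)

text \<open>The second-order Taylor formula is exact for a quadratic with Hessian \<open>b\<close>
  times the identity. Strong convexity with modulus \<open>b\<close> follows with equality, and any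
  \<open>a \<le> b\<close> is then a weakening.\<close>

lemma quadratic_loss_expansion:
  "quadratic_loss b c u = quadratic_loss b c v + (b *\<^sub>R (v - c)) \<bullet> (u - v) + b / 2 * (norm (u - v))\<^sup>2"
  unfolding quadratic_loss_def power2_norm_eq_inner
  by (simp add: inner_diff_left inner_diff_right inner_commute algebra_simps)

lemma strongly_convex_on_quadratic_loss:
  fixes c :: "real ^ 'd"
  assumes "a \<le> b"
  shows "strongly_convex_on \<Omega> a (quadratic_loss b c)"
  unfolding strongly_convex_on_def gradient_quadratic_loss
proof (intro conjI C1_on_quadratic_loss ballI)
  fix u v :: "real ^ 'd"
  have "a / 2 * (norm (u - v))\<^sup>2 \<le> b / 2 * (norm (u - v))\<^sup>2"
    using assms by (intro mult_right_mono) auto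
  then show "quadratic_loss b c v + (b *\<^sub>R (v - c)) \<bullet> (u - v) + a / 2 * (norm (u - v))\<^sup>2
      \<le> quadratic_loss b c u"
    using quadratic_loss_expansion[of b c u v] by linarith
qed

lemma smooth_on_with_quadratic_loss:
  assumes "0 \<le> b"
  shows "smooth_on_with \<Omega> b (quadratic_loss b c)"
  using assms
  by (simp add: smooth_on_with_def C1_on_quadratic_loss gradient_quadratic_loss
      flip: scaleR_diff_right)

lemma quadratic_loss_in_L_sc:
  assumes "a \<le> b" "0 \<le> b" "c \<in> \<Omega>"
  shows "(\<lambda>_. quadratic_loss b c) \<in> L_sc Z \<Omega> a b"
  unfolding L_sc_def
  using assms
  by (auto simp: strongly_convex_on_quadratic_loss smooth_on_with_quadratic_loss
      gradient_quadratic_loss)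

lemma gd_quadratic_loss:
  "gd \<eta> (quadratic_loss b c) \<theta>0 t = c + (1 - \<eta> * b) ^ t *\<^sub>R (\<theta>0 - c)"
proof (induction t)
  case (Suc t)
  \<comment> \<open>Used with \<open>r = (1 - \<eta> * b) ^ t\<close> and
    \<open>v = \<theta>0 - c\<close>: one step multiplies the offset from \<open>c\<close> by
    \<open>1 - \<eta> * b\<close>.\<close>
  have "c + r *\<^sub>R v - \<eta> *\<^sub>R b *\<^sub>R (c + r *\<^sub>R v - c) = c + ((1 - \<eta> * b) * r) *\<^sub>R v" for r v
    by (simp add: algebra_simps)
  with Suc show ?case
    by (simp add: gradient_quadratic_loss)
qed simp

text \<open>The average of \<open>n\<close> equal losses is that loss; for \<open>n = 0\<close> the
  empirical risk would be the zero function.\<close>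

lemma emp_risk_const:
  assumes "n \<ge> 1"
  shows "emp_risk (\<lambda>_. f) n S = f"
  using assms by (auto simp: emp_risk_def)

lemma arg_min_on_quadratic_loss:
  fixes c :: "real ^ 'd"
  assumes "0 < b" "c \<in> \<Omega>"
  shows "is_arg_min (quadratic_loss b c) (\<lambda>x. x \<in> \<Omega>) c"
    and "arg_min_on (quadratic_loss b c) \<Omega> = c"
proof -
  show min: "is_arg_min (quadratic_loss b c) (\<lambda>x. x \<in> \<Omega>) c"
    using assms by (auto simp: is_arg_min_linorder quadratic_loss_def)
  \<comment> \<open>\<open>arg_min_on\<close> is a Hilbert choice, so it is a minimizer once one
    exists, here \<open>c\<close>. Its value is then at most 0, which only \<open>c\<close>
    attains.\<close>
  have "is_arg_min (quadratic_loss b c) (\<lambda>x. x \<in> \<Omega>)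
      (arg_min_on (quadratic_loss b c) \<Omega>)"
    unfolding arg_min_on_def arg_min_def using min by (rule someI)
  then have "quadratic_loss b c (arg_min_on (quadratic_loss b c) \<Omega>) \<le> quadratic_loss b c c"
    using assms(2) unfolding is_arg_min_linorder by blast
  then show "arg_min_on (quadratic_loss b c) \<Omega> = c"
    using assms(1) by (simp add: quadratic_loss_def mult_le_0_iff)
qed

text \<open>For a loss constant in \<open>z\<close> the empirical risk equals the loss for every
  sample, so the expectation integrates a constant over a probability space. The pair also has to
  satisfy \<open>run_defined\<close> to enter the supremum.\<close>

lemma E_opt_ge_quadratic_loss:
  fixes c \<theta>0 :: "real ^ 'd"
  assumes P: "P \<in> \<P>" "prob_space P"
    and \<Omega>: "convex \<Omega>" "\<theta>0 \<in> \<Omega>" "c \<in> \<Omega>"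
    and "a \<le> b" "0 < b" "0 \<le> \<eta>" "\<eta> * b \<le> 1" "1 \<le> n"
  shows "ereal (b / 2 * (norm (\<theta>0 - c))\<^sup>2 * (1 - \<eta> * b) ^ (2 * T))
    \<le> E_opt \<Omega> \<P> \<eta> \<theta>0 T n (L_sc Z \<Omega> a b)"
proof -
  define f where "f = quadratic_loss b c"
  interpret prob_space "\<Pi>\<^sub>M i\<in>{..<n}. P"
    by (rule prob_space_PiM) (rule P)
  have factor: "0 \<le> 1 - \<eta> * b" "1 - \<eta> * b \<le> 1"
    using assms by auto
  have iterates: "gd \<eta> f \<theta>0 t \<in> \<Omega>" for t
  proof -
    \<comment> \<open>The iterate is a convex combination of \<open>c\<close> and
      \<open>\<theta>0\<close>, with weights in [0, 1] because
      \<open>0 \<le> 1 - \<eta> * b \<le> 1\<close>.\<close>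
    have "(1 - (1 - \<eta> * b) ^ t) *\<^sub>R c + (1 - \<eta> * b) ^ t *\<^sub>R \<theta>0 \<in> \<Omega>"
      using \<Omega> factor by (intro convexD) (auto intro: power_le_one)
    then show ?thesis
      by (simp add: f_def gd_quadratic_loss algebra_simps)
  qed
  have "run_defined \<Omega> \<eta> \<theta>0 T n (\<lambda>_. f) P"
    unfolding run_defined_def emp_risk_const[OF \<open>1 \<le> n\<close>]
    using iterates arg_min_on_quadratic_loss(1)[OF \<open>0 < b\<close> \<open>c \<in> \<Omega>\<close>] by (auto simp: f_def)
  moreover have "(\<lambda>_. f) \<in> L_sc Z \<Omega> a b"
    unfolding f_def using assms by (intro quadratic_loss_in_L_sc) auto
  ultimately have "ereal (\<integral>S. emp_risk (\<lambda>_. f) n S (gd \<eta> (emp_risk (\<lambda>_. f) n S) \<theta>0 T)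
      - emp_risk (\<lambda>_. f) n S (arg_min_on (emp_risk (\<lambda>_. f) n S) \<Omega>) \<partial>(\<Pi>\<^sub>M i\<in>{..<n}. P))
      \<le> E_opt \<Omega> \<P> \<eta> \<theta>0 T n (L_sc Z \<Omega> a b)"
    unfolding E_opt_def using \<open>P \<in> \<P>\<close> by (intro SUP_upper2[of "((\<lambda>_. f), P)"]) auto
  moreover have "f (gd \<eta> f \<theta>0 T) - f (arg_min_on f \<Omega>)
      = b / 2 * (norm (\<theta>0 - c))\<^sup>2 * (1 - \<eta> * b) ^ (2 * T)"
    unfolding f_def arg_min_on_quadratic_loss(2)[OF \<open>0 < b\<close> \<open>c \<in> \<Omega>\<close>] gd_quadratic_loss
    by (simp add: quadratic_loss_def power_mult_distrib mult.commute[of 2] flip: power_mult)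
  ultimately show ?thesis
    by (simp add: emp_risk_const[OF \<open>1 \<le> n\<close>] prob_space)
qed

text \<open>Two points more than \<open>2 * r\<close> apart cannot both lie within \<open>r\<close>
  of \<open>x\<close>. For \<open>r \<le> 0\<close> the point \<open>x\<close> itself
  serves.\<close>

lemma ex_norm_ge_of_less_half_diameter:
  fixes x :: "'a :: real_normed_vector"
  assumes "bounded S" "x \<in> S" "r < diameter S / 2"
  shows "\<exists>c\<in>S. max 0 r \<le> norm (x - c)"
proof (cases "0 < r")
  case True
  then have "\<exists>y\<in>S. \<exists>z\<in>S. 2 * r < dist y z"
    using assms by (intro diameter_lower_bounded) auto
  then obtain y z where "y \<in> S" "z \<in> S" "2 * r < dist y z"
    by blast
  moreover have "dist y z \<le> norm (x - y) + norm (x - z)"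
    by (metis dist_norm dist_triangle3)
  ultimately have "r \<le> norm (x - y) \<or> r \<le> norm (x - z)"
    by linarith
  then show ?thesis
    using \<open>y \<in> S\<close> \<open>z \<in> S\<close> by auto
next
  case False
  then show ?thesis using assms(2) by auto
qed

text \<open>As a function of \<open>s\<close> the right side is concave on [0, 1] and vanishes at 0,
  so it lies above its chord. The induction compares the increments in \<open>T\<close>, using
  \<open>1 - x \<le> 1 - s * x\<close>.\<close>

lemma one_minus_power_scale:
  fixes s x :: real
  assumes "0 \<le> s" "s \<le> 1" "0 \<le> x" "x \<le> 1"
  shows "s * (1 - (1 - x) ^ T) \<le> 1 - (1 - s * x) ^ T"
proof (induction T)
  case (Suc T)
  have "s * (x * (1 - x) ^ T) \<le> s * (x * (1 - s * x) ^ T)"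
    using assms mult_right_mono[of s 1 x] by (intro mult_left_mono power_mono) auto
  with Suc show ?case
    by (simp add: algebra_simps)
qed simp

theorem mainTheorem10:
  shows "\<exists>C3::real. 0 < C3 \<and> C3 \<le> universal_cap \<and>
    (\<forall>(Z :: 'z measure) (\<P> :: 'z measure set) (\<Omega> :: (real ^ 'd) set) \<theta>0 R \<alpha> \<beta> \<kappa> \<eta> (T::nat) (n::nat).
       \<P> \<noteq> {} \<and> \<P> \<subseteq> space (prob_algebra Z) \<and>
       convex \<Omega> \<and> bounded \<Omega> \<and> diameter \<Omega> = R \<and> \<theta>0 \<in> \<Omega> \<and>
       0 < \<alpha> \<and> \<alpha> \<le> \<beta> \<and> \<kappa> = \<beta> / \<alpha> \<and>
       0 < \<eta> \<and> \<eta> \<le> 1 / \<beta> \<and> 1 \<le> T \<and> 1 \<le> n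
       \<longrightarrow>
       E_opt \<Omega> \<P> \<eta> \<theta>0 T n (L_sc Z \<Omega> \<alpha> \<beta>) \<ge>
         ereal (\<beta> * R\<^sup>2 / (C3 * real n)
                - 4 * (R * \<beta>)\<^sup>2 / (\<alpha> * real n)
                + 4 * (R * \<beta>)\<^sup>2 / (\<alpha> * real n) * (1 - \<eta> * \<beta> / (1 + \<kappa>)) ^ T))"
proof (intro exI[of _ "8::real"] conjI allI impI; (elim conjE)?)
  fix Z :: "'z measure" and \<P> :: "'z measure set" and \<Omega> :: "(real ^ 'd) set"
    and \<theta>0 :: "real ^ 'd" and R \<alpha> \<beta> \<kappa> \<eta> :: real and T n :: nat
  assume \<P>: "\<P> \<noteq> {}" "\<P> \<subseteq> space (prob_algebra Z)"
    and \<Omega>: "convex \<Omega>" "bounded \<Omega>" "diameter \<Omega> = R" "\<theta>0 \<in> \<Omega>"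
    and \<alpha>: "0 < \<alpha>" "\<alpha> \<le> \<beta>" and \<kappa>: "\<kappa> = \<beta> / \<alpha>"
    and \<eta>: "0 < \<eta>" "\<eta> \<le> 1 / \<beta>" and Tn: "1 \<le> T" "1 \<le> n"
  let ?E = "E_opt \<Omega> \<P> \<eta> \<theta>0 T n (L_sc Z \<Omega> \<alpha> \<beta>)"
  define x where "x = \<eta> * \<beta>"
  have \<beta>: "0 < \<beta>" and \<kappa>1: "1 \<le> \<kappa>"
    using \<alpha> \<kappa> by auto
  have x: "0 \<le> x" "x \<le> 1"
    using \<eta> \<beta> by (auto simp: x_def field_simps)
  \<comment> \<open>Some distribution must exist, since the supremum over an empty set is minus
    infinity.\<close>
  obtain P where P: "P \<in> \<P>" "prob_space P"
    using \<P> by (auto simp: space_prob_algebra)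
  \<comment> \<open>The diameter need not be attained, so \<open>R / 2\<close> is reached only as a
    left limit. Truncation by \<open>max 0 r\<close> keeps squaring monotone and covers
    \<open>R = 0\<close>.\<close>
  have "\<forall>\<^sub>F r in at_left (R / 2). ereal (\<beta> / 2 * (max 0 r)\<^sup>2 * (1 - x) ^ (2 * T)) \<le> ?E"
  proof (rule eventually_at_leftI[of "R / 2 - 1"])
    fix r assume "r \<in> {R / 2 - 1<..<R / 2}"
    then obtain c where c: "c \<in> \<Omega>" "max 0 r \<le> norm (\<theta>0 - c)"
      using ex_norm_ge_of_less_half_diameter[OF \<Omega>(2,4), of r] \<Omega>(3) by auto
    have "\<beta> / 2 * (max 0 r)\<^sup>2 * (1 - x) ^ (2 * T)
        \<le> \<beta> / 2 * (norm (\<theta>0 - c))\<^sup>2 * (1 - x) ^ (2 * T)"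
      using c(2) \<beta> x by (intro mult_right_mono mult_left_mono power_mono) auto
    then have "ereal (\<beta> / 2 * (max 0 r)\<^sup>2 * (1 - x) ^ (2 * T))
        \<le> ereal (\<beta> / 2 * (norm (\<theta>0 - c))\<^sup>2 * (1 - x) ^ (2 * T))"
      by simp
    also have "\<dots> \<le> ?E"
      unfolding x_def using P \<Omega> c \<alpha> \<beta> \<eta> x Tn
      by (intro E_opt_ge_quadratic_loss) (auto simp: x_def)
    finally show "ereal (\<beta> / 2 * (max 0 r)\<^sup>2 * (1 - x) ^ (2 * T)) \<le> ?E" .
  qed simp
  moreover have "((\<lambda>r. ereal (\<beta> / 2 * (max 0 r)\<^sup>2 * (1 - x) ^ (2 * T))) \<longlongrightarrow>
      ereal (\<beta> / 2 * (max 0 (R / 2))\<^sup>2 * (1 - x) ^ (2 * T))) (at_left (R / 2))"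
    by (intro tendsto_intros)
  ultimately have "ereal (\<beta> / 2 * (max 0 (R / 2))\<^sup>2 * (1 - x) ^ (2 * T)) \<le> ?E"
    by (intro tendsto_upperbound) auto
  moreover have "0 \<le> R"
    using \<Omega> diameter_ge_0 by blast
  \<comment> \<open>The constant 8 arises here:
    \<open>\<beta> / 2 * (R / 2)\<^sup>2 = \<beta> * R\<^sup>2 / 8\<close>.\<close>
  ultimately have E: "ereal (\<beta> * R\<^sup>2 / 8 * (1 - x) ^ (2 * T)) \<le> ?E"
    by (simp add: max_def power_divide)
  define p where "p = (1 - x) ^ T"
  define q where "q = (1 - x / (1 + \<kappa>)) ^ T"
  have p: "0 \<le> p" "p \<le> 1"
    using x by (auto simp: p_def intro: power_le_one)
  have "1 / (1 + \<kappa>) * (1 - p) \<le> 1 - q"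
    using one_minus_power_scale[of "1 / (1 + \<kappa>)" x T] x \<kappa>1 by (simp add: p_def q_def)
  \<comment> \<open>The factor is the ratio of the two coefficients in the claim:
    \<open>4 * (R * \<beta>)\<^sup>2 / \<alpha>\<close> is \<open>32 * \<kappa>\<close> times
    \<open>\<beta> * R\<^sup>2 / 8\<close>.\<close>
  then have "32 * \<kappa> * (1 / (1 + \<kappa>) * (1 - p)) \<le> 32 * \<kappa> * (1 - q)"
    using \<kappa>1 by (intro mult_left_mono) auto
  \<comment> \<open>From \<open>\<kappa> \<ge> 1\<close> the coefficient on the right is at least
    16; 2 suffices to dominate \<open>1 - p\<^sup>2\<close>.\<close>
  moreover have "2 * (1 - p) \<le> 32 * \<kappa> / (1 + \<kappa>) * (1 - p)"
    using p \<kappa>1 by (intro mult_right_mono) (auto simp: field_simps)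
  moreover have "1 - p\<^sup>2 \<le> 2 * (1 - p)"
    using zero_le_power2[of "1 - p"] by (simp add: power2_eq_square algebra_simps)
  ultimately have key: "1 - 32 * \<kappa> * (1 - q) \<le> p\<^sup>2"
    by simp
  have "\<beta> * R\<^sup>2 / (8 * real n) - 4 * (R * \<beta>)\<^sup>2 / (\<alpha> * real n) + 4 * (R * \<beta>)\<^sup>2 / (\<alpha> * real n) * q
      = \<beta> * R\<^sup>2 / 8 * (1 - 32 * \<kappa> * (1 - q)) / real n"
    using \<alpha> Tn by (simp add: \<kappa> field_simps power2_eq_square)
  also have "\<dots> \<le> \<beta> * R\<^sup>2 / 8 * p\<^sup>2 / real n"
    using key \<beta> by (intro divide_right_mono mult_left_mono) auto
  also have "\<dots> \<le> \<beta> * R\<^sup>2 / 8 * p\<^sup>2 / 1"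
    using \<beta> Tn by (intro divide_left_mono) auto
  finally have "ereal (\<beta> * R\<^sup>2 / (8 * real n) - 4 * (R * \<beta>)\<^sup>2 / (\<alpha> * real n)
      + 4 * (R * \<beta>)\<^sup>2 / (\<alpha> * real n) * q) \<le> ereal (\<beta> * R\<^sup>2 / 8 * (1 - x) ^ (2 * T))"
    by (simp add: p_def mult.commute flip: power_mult)
  also note E
  finally show "ereal (\<beta> * R\<^sup>2 / (8 * real n) - 4 * (R * \<beta>)\<^sup>2 / (\<alpha> * real n)
      + 4 * (R * \<beta>)\<^sup>2 / (\<alpha> * real n) * (1 - \<eta> * \<beta> / (1 + \<kappa>)) ^ T) \<le> ?E"
    by (simp add: q_def x_def)
qed (simp_all add: universal_cap_def)

end
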